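(* Let $J\ge 3$ and let $A$ be the square matrix of dimension $J-1$ with $A_{i,i}=1$ for $1\le i\le J-1$, $A_{i,i-1}=-1$ for $2\le i\le J-1$, and all other entries $0$; let $A^t$ be its transpose. Then, for every design matrix $Z\in\mathfrak{Z}$, the following two models are equal: $$(\text{reference},\ \text{logistic},\ Z)=(\text{adjacent},\ \text{logistic},\ A^tZ).$$
   Context: Setting. Let $J\ge 3$ (number of categories), $p\ge 1$, and let $\mathcal{X}\subseteq\mathbb{R}^p$ be the nonempty set of values of the explanatory vector $x$. Let $\mathcal{M}=\{\pi\in\,]0,1[^{J-1} : \sum_{j=1}^{J-1}\pi_j<1\}$; for $\pi\in\mathcal{M}$ put $\pi_J=1-\sum_{j=1}^{J-1}\pi_j$ ($\pi_j$ is the probability of category $j$). Ratios. The reference ratio $r:\mathcal{M}\to\,]0,1[^{J-1}$ is $r_j(\pi)=\pi_j/(\pi_j+\pi_J)$; the adjacent ratio is $r_j(\pi)=\pi_j/(\pi_j+\pi_{j+1})$, for $j=1,\dots,J-1$. Each is a bijection from $\mathcal{M}$ onto $]0,1[^{J-1}$. Cdf. The logistic cdf is $F(w)=e^w/(1+e^w)$, $w\in\mathbb{R}$. Design matrices. The complete design matrix $Z_c(x)$ is the $(J-1)\times(J-1)(1+p)$ matrix with $Z_c(x)\beta=(\alpha_j+x^t\delta_j)_{j=1,\dots,J-1}$ for $\beta=(\alpha_1,\dots,\alpha_{J-1},\delta_1^t,\dots,\delta_{J-1}^t)^t$, $\alpha_j\in\mathbb{R}$, $\delta_j\in\mathbb{R}^p$.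 The set $\mathfrak{Z}$ of design matrices consists of all matrix functions $Z:x\mapsto Z_c(x)C$, where $C$ is a constant real matrix of full column rank with $q$ columns, $J-1+p\le q\le (J-1)(1+p)$. For a constant matrix $M$ of dimension $J-1$, $MZ$ denotes $x\mapsto MZ(x)$. Models. A model $(r,F,Z)$, where $r$ is the reference ratio or the adjacent ratio, $F$ is the logistic cdf and $Z\in\mathfrak{Z}$ has $q$ columns, has parameter space $\mathbb{R}^q$. For $\beta\in\mathbb{R}^q$ and $x\in\mathcal{X}$, it defines the unique $\pi=\pi(x;\beta)\in\mathcal{M}$ with $r(\pi)=(F(\eta_1),\dots,F(\eta_{J-1}))^t$, where $\eta=Z(x)\beta$. Two models are equal if they have the same parameter space and give the same $\pi(x;\beta)$ for all $x\in\mathcal{X}$ and all $\beta$ in it. *)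

theory Defs
  imports Complex_Main "Jordan_Normal_Form.DL_Rank"
begin

text \<open>
  Indices are shifted to start at 0: the categories \<open>1, \<dots>, J\<close> are \<open>0, \<dots>, J - 1\<close>, and vectors
  of \<open>\<real>\<^sup>n\<close> are elements of \<open>carrier_vec n\<close>.
\<close>

definition probs :: "nat \<Rightarrow> real vec set" where
  "probs J = {\<pi> \<in> carrier_vec (J - 1).
     (\<forall>j < J - 1. 0 < \<pi> $ j \<and> \<pi> $ j < 1) \<and> (\<Sum>j < J - 1. \<pi> $ j) < 1}"

definition cat_prob :: "nat \<Rightarrow> real vec \<Rightarrow> nat \<Rightarrow> real" where
  "cat_prob J \<pi> j = (if j < J - 1 then \<pi> $ j else 1 - (\<Sum>i < J - 1. \<pi> $ i))"

definition reference_ratio :: "nat \<Rightarrow> real vec \<Rightarrow> real vec" where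
  "reference_ratio J \<pi> =
     vec (J - 1) (\<lambda>j. cat_prob J \<pi> j / (cat_prob J \<pi> j + cat_prob J \<pi> (J - 1)))"

definition adjacent_ratio :: "nat \<Rightarrow> real vec \<Rightarrow> real vec" where
  "adjacent_ratio J \<pi> =
     vec (J - 1) (\<lambda>j. cat_prob J \<pi> j / (cat_prob J \<pi> j + cat_prob J \<pi> (j + 1)))"

definition logistic :: "real \<Rightarrow> real" where
  "logistic w = exp w / (1 + exp w)"

text \<open>
  Column \<open>j < J - 1\<close> of the complete design matrix belongs to the intercept \<open>\<alpha>\<^sub>j\<close>, and column
  \<open>J - 1 + j * p + k\<close> with \<open>k < p\<close> to the \<open>k\<close>-th component of the slope \<open>\<delta>\<^sub>j\<close>.
\<close>

definition complete_design :: "nat \<Rightarrow> nat \<Rightarrow> real vec \<Rightarrow> real mat" where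
  "complete_design J p x = mat (J - 1) ((J - 1) * (1 + p)) (\<lambda>(i, c).
     if c < J - 1 then (if c = i then 1 else 0)
     else (if (c - (J - 1)) div p = i then x $ ((c - (J - 1)) mod p) else 0))"

text \<open>
  Design matrices are functions on the set \<open>X\<close> of values of the explanatory vector; the values
  of the HOL function outside \<open>X\<close> are irrelevant.
\<close>

definition design_matrices :: "nat \<Rightarrow> nat \<Rightarrow> real vec set \<Rightarrow> (real vec \<Rightarrow> real mat) set" where
  "design_matrices J p X = {Z. \<exists>q C.
     J - 1 + p \<le> q \<and> q \<le> (J - 1) * (1 + p) \<and>
     C \<in> carrier_mat ((J - 1) * (1 + p)) q \<and>
     vec_space.rank ((J - 1) * (1 + p)) C = q \<and>
     (\<forall>x \<in> X. Z x = complete_design J p x * C)}"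

type_synonym model = "(real vec \<Rightarrow> real vec) \<times> (real \<Rightarrow> real) \<times> (real vec \<Rightarrow> real mat)"

text \<open>
  For a design matrix \<open>Z\<close> with \<open>q\<close> columns and nonempty \<open>X\<close>, the parameter space is
  \<open>carrier_vec q\<close>.
\<close>

fun param_space :: "real vec set \<Rightarrow> model \<Rightarrow> real vec set" where
  "param_space X (r, F, Z) = {\<beta>. \<forall>x \<in> X. \<beta> \<in> carrier_vec (dim_col (Z x))}"

fun model_prob :: "nat \<Rightarrow> model \<Rightarrow> real vec \<Rightarrow> real vec \<Rightarrow> real vec" where
  "model_prob J (r, F, Z) x \<beta> = (THE \<pi>. \<pi> \<in> probs J \<and> r \<pi> = map_vec F (Z x *\<^sub>v \<beta>))"

definition models_equal :: "nat \<Rightarrow> real vec set \<Rightarrow> model \<Rightarrow> model \<Rightarrow> bool" where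
  "models_equal J X m1 m2 \<longleftrightarrow>
     param_space X m1 = param_space X m2 \<and>
     (\<forall>x \<in> X. \<forall>\<beta> \<in> param_space X m1. model_prob J m1 x \<beta> = model_prob J m2 x \<beta>)"

lemma complete_design_mult:
  assumes "\<beta> \<in> carrier_vec ((J - 1) * (1 + p))" and "x \<in> carrier_vec p"
  shows "complete_design J p x *\<^sub>v \<beta> =
    vec (J - 1) (\<lambda>j. \<beta> $ j + x \<bullet> vec p (\<lambda>k. \<beta> $ (J - 1 + j * p + k)))"
proof (rule eq_vecI)
  show "dim_vec (complete_design J p x *\<^sub>v \<beta>) =
      dim_vec (vec (J - 1) (\<lambda>j. \<beta> $ j + x \<bullet> vec p (\<lambda>k. \<beta> $ (J - 1 + j * p + k))))"
    by (simp add: complete_design_def)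
next
  fix j assume "j < dim_vec (vec (J - 1) (\<lambda>j. \<beta> $ j + x \<bullet> vec p (\<lambda>k. \<beta> $ (J - 1 + j * p + k))))"
  then have j: "j < J - 1" by simp
  define n where "n = J - 1"
  define g where "g c = (if c < n then (if c = j then 1 else 0)
     else (if (c - n) div p = j then x $ ((c - n) mod p) else 0)) * \<beta> $ c" for c
  define T where "T = (\<lambda>k. n + j * p + k) ` {..<p}"
  have jn: "j < n" using j n_def by simp
  have N: "(J - 1) * (1 + p) = n + n * p" by (simp add: n_def)
  have jp: "j * p + p \<le> n * p"
    using mult_le_mono1[of "Suc j" n p] jn by simp
  have "(complete_design J p x *\<^sub>v \<beta>) $ j = (\<Sum>c<n + n * p. g c)"
    using j assms unfolding complete_design_def N
    by (auto simp: scalar_prod_def g_def n_def lessThan_atLeast0 intro!: sum.cong)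
  also have "\<dots> = (\<Sum>c\<in>insert j T. g c)"
  proof (rule sum.mono_neutral_right)
    show "insert j T \<subseteq> {..<n + n * p}" using jn jp by (auto simp: T_def)
    show "\<forall>c\<in>{..<n + n * p} - insert j T. g c = 0"
    proof
      fix c assume c: "c \<in> {..<n + n * p} - insert j T"
      show "g c = 0"
      proof (cases "c < n")
        case True then show ?thesis using c by (simp add: g_def)
      next
        case False
        have p: "0 < p" using False c by (cases p) auto
        have "(c - n) div p \<noteq> j"
        proof
          assume d: "(c - n) div p = j"
          have "c = n + j * p + (c - n) mod p"
            using False d div_mult_mod_eq[of "c - n" p] by simp
          then have "c \<in> T" using p by (auto simp: T_def)
          then show False using c by simp
        qed
        then show ?thesis using False by (simp add: g_def)
      qed
    qed
  qed simp
  also have "\<dots> = g j + (\<Sum>c\<in>T. g c)"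
    using jn by (subst sum.insert) (auto simp: T_def)
  also have "(\<Sum>c\<in>T. g c) = (\<Sum>k<p. g (n + j * p + k))"
    unfolding T_def by (subst sum.reindex) (auto simp: inj_on_def)
  also have "\<dots> = (\<Sum>k<p. x $ k * \<beta> $ (n + j * p + k))"
    by (rule sum.cong) (auto simp: g_def)
  finally show "(complete_design J p x *\<^sub>v \<beta>) $ j =
      vec (J - 1) (\<lambda>j. \<beta> $ j + x \<bullet> vec p (\<lambda>k. \<beta> $ (J - 1 + j * p + k))) $ j"
    using j jn by (simp add: g_def scalar_prod_def n_def lessThan_atLeast0)
qed

lemma ex1_probs_weights:
  assumes w: "\<And>j. j < J - 1 \<Longrightarrow> 0 < w j"
  shows "\<exists>!\<pi>. \<pi> \<in> probs J \<and> (\<forall>j < J - 1. cat_prob J \<pi> j = w j * cat_prob J \<pi> (J - 1))"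
proof -
  define n where "n = J - 1"
  define S where "S = 1 + (\<Sum>j<n. w j)"
  define P where "P = vec n (\<lambda>j. w j / S)"
  have "0 \<le> (\<Sum>j<n. w j)"
    by (rule sum_nonneg) (use w in \<open>auto simp: n_def intro: less_imp_le\<close>)
  then have S: "S \<ge> 1" by (simp add: S_def)
  have sum: "(\<Sum>j<n. P $ j) = (\<Sum>j<n. w j) / S"
    unfolding sum_divide_distrib by (rule sum.cong) (auto simp: P_def)
  have last: "1 - (\<Sum>j<n. P $ j) = 1 / S"
  proof -
    have "(\<Sum>j<n. w j) = S - 1" by (simp add: S_def)
    then show ?thesis unfolding sum using S by (simp add: diff_divide_distrib)
  qed
  have wj: "0 < w j" if "j < n" for j using w that by (simp add: n_def)
  have "w j < S" if "j < n" for j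
  proof -
    have "w j \<le> (\<Sum>j<n. w j)"
      by (rule member_le_sum) (use that wj in \<open>auto intro: less_imp_le\<close>)
    then show ?thesis by (simp add: S_def)
  qed
  then have "0 < P $ j \<and> P $ j < 1" if "j < n" for j
    using that wj[OF that] S by (simp add: P_def)
  moreover have "(\<Sum>j<n. P $ j) < 1"
  proof -
    have "0 < 1 / S" using S by simp
    then show ?thesis using last by linarith
  qed
  moreover have "P \<in> carrier_vec n" by (simp add: P_def)
  ultimately have "P \<in> probs J"
    unfolding probs_def n_def[symmetric] by blast
  moreover have "\<forall>j < J - 1. cat_prob J P j = w j * cat_prob J P (J - 1)"
    using last unfolding cat_prob_def n_def[symmetric] by (simp add: P_def)
  moreover have "Q = P" if Q: "Q \<in> probs J"
    and Qw: "\<forall>j < J - 1. cat_prob J Q j = w j * cat_prob J Q (J - 1)" for Q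
  proof -
    define l where "l = cat_prob J Q (J - 1)"
    have Qj: "Q $ j = w j * l" if "j < n" for j
    proof -
      have "cat_prob J Q j = w j * l" using Qw that unfolding l_def n_def by blast
      then show ?thesis using that by (simp add: cat_prob_def n_def)
    qed
    have "1 = l + (\<Sum>j<n. Q $ j)"
      unfolding l_def cat_prob_def n_def[symmetric] by simp
    also have "(\<Sum>j<n. Q $ j) = (\<Sum>j<n. w j) * l"
      unfolding sum_distrib_right by (rule sum.cong) (use Qj in auto)
    finally have "1 = S * l" by (simp only: S_def distrib_right mult_1_left)
    then have "l = 1 / S" using S by (simp add: eq_divide_eq mult.commute)
    then have "Q $ j = P $ j" if "j < n" for j
      using that Qj[OF that] by (simp add: P_def)
    moreover have "dim_vec Q = n" "dim_vec P = n"
      using Q by (simp_all add: probs_def P_def n_def)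
    ultimately show ?thesis by (intro eq_vecI) simp_all
  qed
  ultimately show ?thesis by (intro ex1I[of _ P]) blast+
qed

lemma cat_prob_pos:
  assumes "\<pi> \<in> probs J"
  shows "0 < cat_prob J \<pi> j"
  using assms by (auto simp: probs_def cat_prob_def)

lemma ratio_eq_iff:
  fixes a b u :: real
  assumes "0 < a" "0 < b" "0 < u" "u < 1"
  shows "a / (a + b) = u \<longleftrightarrow> a = u / (1 - u) * b"
  using assms by (auto simp: field_simps)

text \<open>
  Both ratios are bijections from \<open>probs J\<close> onto the open cube, so the description in
  \<open>model_prob\<close> always denotes.
\<close>

lemma ex1_reference_ratio:
  assumes u: "u \<in> carrier_vec (J - 1)" "\<And>j. j < J - 1 \<Longrightarrow> 0 < u $ j \<and> u $ j < 1"
  shows "\<exists>!\<pi>. \<pi> \<in> probs J \<and> reference_ratio J \<pi> = u"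
proof -
  define w where "w j = u $ j / (1 - u $ j)" for j
  have "reference_ratio J \<pi> = u \<longleftrightarrow> (\<forall>j < J - 1. cat_prob J \<pi> j = w j * cat_prob J \<pi> (J - 1))"
    if "\<pi> \<in> probs J" for \<pi>
  proof -
    have "reference_ratio J \<pi> = u \<longleftrightarrow>
        (\<forall>j < J - 1. cat_prob J \<pi> j / (cat_prob J \<pi> j + cat_prob J \<pi> (J - 1)) = u $ j)"
      using u(1) by (auto simp: reference_ratio_def vec_eq_iff)
    also have "\<dots> \<longleftrightarrow> (\<forall>j < J - 1. cat_prob J \<pi> j = w j * cat_prob J \<pi> (J - 1))"
      using u(2) ratio_eq_iff[OF cat_prob_pos[OF that] cat_prob_pos[OF that]]
      unfolding w_def by blast
    finally show ?thesis .
  qed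
  moreover have "\<exists>!\<pi>. \<pi> \<in> probs J \<and> (\<forall>j < J - 1. cat_prob J \<pi> j = w j * cat_prob J \<pi> (J - 1))"
    by (rule ex1_probs_weights) (use u(2) in \<open>auto simp: w_def\<close>)
  ultimately show ?thesis by (simp cong: conj_cong)
qed

lemma ex1_adjacent_ratio:
  assumes u: "u \<in> carrier_vec (J - 1)" "\<And>j. j < J - 1 \<Longrightarrow> 0 < u $ j \<and> u $ j < 1"
  shows "\<exists>!\<pi>. \<pi> \<in> probs J \<and> adjacent_ratio J \<pi> = u"
proof -
  define w where "w j = u $ j / (1 - u $ j)" for j
  define v where "v j = (\<Prod>k = j..<J - 1. w k)" for j
  have v_step: "v j = w j * v (j + 1)" if "j < J - 1" for j
    using that by (simp add: v_def prod.atLeast_Suc_lessThan)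
  have v_last: "v (J - 1) = 1" by (simp add: v_def)
  have "adjacent_ratio J \<pi> = u \<longleftrightarrow> (\<forall>j < J - 1. cat_prob J \<pi> j = v j * cat_prob J \<pi> (J - 1))"
    if "\<pi> \<in> probs J" for \<pi>
  proof -
    let ?c = "cat_prob J \<pi>"
    have "adjacent_ratio J \<pi> = u \<longleftrightarrow> (\<forall>j < J - 1. ?c j / (?c j + ?c (j + 1)) = u $ j)"
      using u(1) by (auto simp: adjacent_ratio_def vec_eq_iff)
    also have "\<dots> \<longleftrightarrow> (\<forall>j < J - 1. ?c j = w j * ?c (j + 1))"
      using u(2) ratio_eq_iff[OF cat_prob_pos[OF that] cat_prob_pos[OF that]]
      unfolding w_def by blast
    also have "\<dots> \<longleftrightarrow> (\<forall>j < J - 1. ?c j = v j * ?c (J - 1))"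
    proof
      assume s: "\<forall>j < J - 1. ?c j = w j * ?c (j + 1)"
      have "?c j = v j * ?c (J - 1)" if "j \<le> J - 1" for j
        using that
      proof (induction rule: inc_induct)
        case base then show ?case by (simp only: v_last mult_1_left)
      next
        case (step m)
        have "?c m = w m * ?c (Suc m)" using s step.hyps by simp
        then show ?case
          using step.IH v_step[of m] step.hyps by (simp only: mult.assoc Suc_eq_plus1)
      qed
      then show "\<forall>j < J - 1. ?c j = v j * ?c (J - 1)" by (blast intro: less_imp_le)
    next
      assume s: "\<forall>j < J - 1. ?c j = v j * ?c (J - 1)"
      have all: "?c j = v j * ?c (J - 1)" if "j \<le> J - 1" for j
      proof (cases "j = J - 1")
        case True
        then show ?thesis by (simp only: v_last mult_1_left)
      next
        case False
        then show ?thesis using s that by simp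
      qed
      show "\<forall>j < J - 1. ?c j = w j * ?c (j + 1)"
      proof (intro allI impI)
        fix j assume j: "j < J - 1"
        have "?c j = w j * (v (j + 1) * ?c (J - 1))"
          using all[of j] v_step[OF j] j by (simp only: less_imp_le mult.assoc)
        also have "v (j + 1) * ?c (J - 1) = ?c (j + 1)"
          using all[of "j + 1"] j by linarith
        finally show "?c j = w j * ?c (j + 1)" .
      qed
    qed
    finally show ?thesis .
  qed
  moreover have "\<exists>!\<pi>. \<pi> \<in> probs J \<and> (\<forall>j < J - 1. cat_prob J \<pi> j = v j * cat_prob J \<pi> (J - 1))"
    by (rule ex1_probs_weights) (use u(2) in \<open>auto simp: v_def w_def intro!: prod_pos\<close>)
  ultimately show ?thesis by (simp cong: conj_cong)
qed

end

theory Submission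
  imports Defs
begin

text \<open>
  In terms of \<open>\<eta> = Z(x)\<beta>\<close>, the reference model says \<open>\<pi>\<^sub>j / \<pi>\<^sub>J = exp \<eta>\<^sub>j\<close> and the adjacent model
  with predictor \<open>\<eta>'\<close> says \<open>\<pi>\<^sub>j / \<pi>\<^sub>j\<^sub>+\<^sub>1 = exp \<eta>'\<^sub>j\<close>. With \<open>\<eta>\<^sub>J = 0\<close> these agree exactly if
  \<open>\<eta>'\<^sub>j = \<eta>\<^sub>j - \<eta>\<^sub>j\<^sub>+\<^sub>1\<close>, that is, \<open>\<eta>' = A\<^sup>t\<eta>\<close>. That \<open>A\<^sup>tZ\<close> is again a design matrix holds because
  acting on the predictors by an invertible matrix amounts to acting on the intercepts and on each
  coordinate of the slopes, which multiplies \<open>C\<close> from the left by an injective matrix.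
\<close>

section \<open>Full column rank as triviality of the kernel\<close>

text \<open>Independence is that of the set of columns, so it matches a trivial kernel only when no
  column is repeated. Each side of the equivalence excludes repetitions.\<close>

lemma (in vec_space) full_column_rank_iff:
  assumes C: "C \<in> carrier_mat n nc"
  shows "rank C = nc \<longleftrightarrow> (\<forall>v \<in> carrier_vec nc. C *\<^sub>v v = 0\<^sub>v n \<longrightarrow> v = 0\<^sub>v nc)"
proof
  assume rk: "rank C = nc"
  have "distinct (cols C)"
  proof -
    \<comment> \<open>The rank is the size of a maximal independent set of columns, so rank
      \<open>nc\<close> forces \<open>nc\<close> different columns.\<close>
    obtain S where S: "maximal S (\<lambda>T. T \<subseteq> set (cols C) \<and> lin_indpt T)"
      using maximal_exists_superset[of "set (cols C)" "\<lambda>T. T \<subseteq> set (cols C) \<and> lin_indpt T" "{}"]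
      by (auto simp: finite_lin_indpt2)
    then have "nc = card S" using rank_card_indpt[OF C] rk by simp
    also have "\<dots> \<le> card (set (cols C))"
      using S by (intro card_mono) (auto simp: maximal_def)
    finally have "length (cols C) \<le> card (set (cols C))" using C by simp
    then show ?thesis by (intro card_distinct le_antisym card_length)
  qed
  then show "\<forall>v \<in> carrier_vec nc. C *\<^sub>v v = 0\<^sub>v n \<longrightarrow> v = 0\<^sub>v nc"
    using lin_depI[OF C] full_rank_lin_indpt[OF C rk] by blast
next
  assume inj: "\<forall>v \<in> carrier_vec nc. C *\<^sub>v v = 0\<^sub>v n \<longrightarrow> v = 0\<^sub>v nc"
  have "distinct (cols C)"
  proof (rule ccontr)
    assume "\<not> distinct (cols C)"
    then obtain i j where ij: "i < nc" "j < nc" "i \<noteq> j" "col C i = col C j"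
      using C by (auto simp: distinct_conv_nth)
    \<comment> \<open>Two equal columns put this nonzero vector into the kernel.\<close>
    let ?v = "unit_vec nc i - unit_vec nc j :: 'a vec"
    have "C *\<^sub>v ?v = C *\<^sub>v unit_vec nc i - C *\<^sub>v unit_vec nc j"
      using C by (intro mult_minus_distrib_mat_vec) auto
    also have "\<dots> = col C i - col C j"
      using C ij(1,2) by (intro eq_vecI) auto
    also have "\<dots> = 0\<^sub>v n"
      unfolding ij(4) using C by (intro eq_vecI) auto
    finally have "?v = 0\<^sub>v nc" using inj by auto
    then have "?v $ i = 0" using ij by simp
    then show False using ij by simp
  qed
  then show "rank C = nc"
    using lin_depE[OF C] lin_indpt_full_rank[OF C] inj by metis
qed

section \<open>Design matrices under left multiplication by an invertible matrix\<close>

text \<open>This is the block diagonal matrix with blocks \<open>M\<close> (intercepts) and the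
  Kronecker product of \<open>M\<close> with the identity of size \<open>p\<close> (slopes), in the
  column order of \<open>complete_design\<close>.\<close>

definition parameter_action :: "nat \<Rightarrow> nat \<Rightarrow> real mat \<Rightarrow> real mat" where
  "parameter_action n p M = mat (n * (1 + p)) (n * (1 + p)) (\<lambda>(r, c).
     if r < n \<and> c < n then M $$ (r, c)
     else if n \<le> r \<and> n \<le> c \<and> (r - n) mod p = (c - n) mod p
       then M $$ ((r - n) div p, (c - n) div p)
     else 0)"

lemma complete_design_carrier:
  "complete_design J p x \<in> carrier_mat (J - 1) ((J - 1) * (1 + p))"
  by (simp add: complete_design_def)

lemma slope_index_less:
  fixes n p i k :: nat
  assumes "i < n" "k < p"
  shows "n + i * p + k < n * (1 + p)"
proof -
  have "i * p + p \<le> n * p" using mult_le_mono1[of "Suc i" n p] assms by simp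
  then show ?thesis using assms by simp
qed

lemma mult_complete_design:
  assumes M: "M \<in> carrier_mat (J - 1) (J - 1)" and x: "x \<in> carrier_vec p"
  shows "M * complete_design J p x = complete_design J p x * parameter_action (J - 1) p M"
proof -
  define n where "n = J - 1"
  let ?N = "n * (1 + p)"
  let ?B = "parameter_action n p M"
  have D: "complete_design J p x \<in> carrier_mat n ?N"
    unfolding n_def by (rule complete_design_carrier)
  have M': "M \<in> carrier_mat n n" using M by (simp add: n_def)
  have B: "?B \<in> carrier_mat ?N ?N" by (simp add: parameter_action_def)
  have "(M * complete_design J p x) $$ (i, c) = (complete_design J p x * ?B) $$ (i, c)"
    if i: "i < n" and c: "c < ?N" for i c
  proof -
    let ?j = "(c - n) div p" and ?k = "(c - n) mod p"
    have L: "(M * complete_design J p x) $$ (i, c) =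
        (\<Sum>j<n. M $$ (i, j) * complete_design J p x $$ (j, c))"
      using M' D i c by (auto simp: scalar_prod_def lessThan_atLeast0 intro!: sum.cong)
    have "col ?B c \<in> carrier_vec ?N" using B by (intro carrier_vecI) auto
    \<comment> \<open>Column \<open>c\<close> of \<open>?B\<close> is read as a parameter vector, so
      its predictors are given by intercepts and slopes.\<close>
    then have E: "complete_design J p x *\<^sub>v col ?B c =
        vec n (\<lambda>j. col ?B c $ j + x \<bullet> vec p (\<lambda>k. col ?B c $ (n + j * p + k)))"
      by (rule complete_design_mult[OF _ x, where J = J, folded n_def])
    have "(complete_design J p x * ?B) $$ (i, c) = (complete_design J p x *\<^sub>v col ?B c) $ i"
      using D B i c by simp
    also have "\<dots> = col ?B c $ i + x \<bullet> vec p (\<lambda>k. col ?B c $ (n + i * p + k))"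
      unfolding E using i by (rule index_vec)
    also have "\<dots> = ?B $$ (i, c) + (\<Sum>k<p. x $ k * ?B $$ (n + i * p + k, c))"
      using B i c slope_index_less[OF i]
      by (auto simp: scalar_prod_def lessThan_atLeast0 intro!: sum.cong)
    finally have R: "(complete_design J p x * ?B) $$ (i, c) =
        ?B $$ (i, c) + (\<Sum>k<p. x $ k * ?B $$ (n + i * p + k, c))" .
    show ?thesis
    proof (cases "c < n")
      case True
      \<comment> \<open>An intercept column of the complete design is a unit vector.\<close>
      have "(\<Sum>j<n. M $$ (i, j) * complete_design J p x $$ (j, c)) =
          (\<Sum>j<n. if j = c then M $$ (i, j) else 0)"
        using True c by (intro sum.cong) (auto simp: complete_design_def n_def)
      also have "\<dots> = M $$ (i, c)" using True by simp
      moreover have "(\<Sum>k<p. x $ k * ?B $$ (n + i * p + k, c)) = 0"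
        using True i c slope_index_less[OF i]
        by (intro sum.neutral) (auto simp: parameter_action_def)
      moreover have "?B $$ (i, c) = M $$ (i, c)"
        using True i c by (simp add: parameter_action_def)
      ultimately show ?thesis unfolding L R by simp
    next
      case False
      have p: "0 < p" using False c by (cases p) auto
      have "c - n < n * p" using False c by simp
      then have j: "?j < n" by (simp add: less_mult_imp_div_less)
      have k: "?k < p" using p by simp
      \<comment> \<open>Column \<open>c\<close> belongs to coordinate \<open>?k\<close> of slope
        \<open>?j\<close>: its only possibly nonzero entry is \<open>x $ ?k\<close>, in row
        \<open>?j\<close>.\<close>
      have "(\<Sum>j<n. M $$ (i, j) * complete_design J p x $$ (j, c)) =
          (\<Sum>j<n. if j = ?j then M $$ (i, j) * x $ ?k else 0)"
        using False c by (intro sum.cong) (auto simp: complete_design_def n_def)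
      also have "\<dots> = M $$ (i, ?j) * x $ ?k" using j by simp
      moreover have "(\<Sum>k<p. x $ k * ?B $$ (n + i * p + k, c)) =
          (\<Sum>k<p. if k = ?k then x $ k * M $$ (i, ?j) else 0)"
        using False i c slope_index_less[OF i]
        by (intro sum.cong) (auto simp: parameter_action_def)
      moreover have "\<dots> = x $ ?k * M $$ (i, ?j)" using k by simp
      moreover have "?B $$ (i, c) = 0"
        using False i c by (simp add: parameter_action_def)
      ultimately show ?thesis unfolding L R by simp
    qed
  qed
  then show ?thesis
    unfolding n_def[symmetric] using M' D B by (intro eq_matI) auto
qed

text \<open>The value at \<open>x = 0\<close> isolates the intercepts; the unit vectors then isolate
  the slope coordinates.\<close>

lemma complete_design_identifiable:
  assumes v: "v \<in> carrier_vec ((J - 1) * (1 + p))"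
    and zero: "\<And>x. x \<in> carrier_vec p \<Longrightarrow> complete_design J p x *\<^sub>v v = 0\<^sub>v (J - 1)"
  shows "v = 0\<^sub>v ((J - 1) * (1 + p))"
proof -
  define n where "n = J - 1"
  have eq: "v $ j + x \<bullet> vec p (\<lambda>k. v $ (n + j * p + k)) = 0"
    if "j < n" "x \<in> carrier_vec p" for j x
  proof -
    have "(complete_design J p x *\<^sub>v v) $ j = 0"
      using zero[OF that(2)] that(1) by (simp add: n_def)
    then show ?thesis
      using complete_design_mult[OF v that(2)] that(1) by (simp add: n_def)
  qed
  have int: "v $ j = 0" if "j < n" for j
    using eq[OF that, of "0\<^sub>v p"] by simp
  have slope: "v $ (n + j * p + k) = 0" if "j < n" "k < p" for j k
    using eq[OF that(1), of "unit_vec p k"] int[OF that(1)] that(2) by simp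
  have "v $ c = 0" if c: "c < n * (1 + p)" for c
  proof (cases "c < n")
    case True
    then show ?thesis by (rule int)
  next
    case False
    have p: "0 < p" using False c by (cases p) auto
    have "c - n < n * p" using False c by simp
    then have "(c - n) div p < n" by (simp add: less_mult_imp_div_less)
    then have "v $ (n + (c - n) div p * p + (c - n) mod p) = 0"
      using p by (intro slope) simp_all
    moreover have "n + (c - n) div p * p + (c - n) mod p = c"
      using False by (simp add: add.assoc)
    ultimately show ?thesis by (simp only:)
  qed
  then show ?thesis using v by (intro eq_vecI) (auto simp: n_def)
qed

text \<open>The new constant matrix is \<open>?B * C\<close>, with the same number of columns. It
  has full column rank because \<open>?B\<close> and \<open>C\<close> both have trivial
  kernel.\<close>

lemma mult_design_matrices:
  assumes M: "M \<in> carrier_mat (J - 1) (J - 1)" and det: "det M \<noteq> 0"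
    and X: "X \<subseteq> carrier_vec p" and Z: "Z \<in> design_matrices J p X"
  shows "(\<lambda>x. M * Z x) \<in> design_matrices J p X"
proof -
  define N where "N = (J - 1) * (1 + p)"
  let ?D = "complete_design J p" and ?B = "parameter_action (J - 1) p M"
  obtain q C where q: "J - 1 + p \<le> q" "q \<le> N" and C: "C \<in> carrier_mat N q"
    and rk: "vec_space.rank N C = q" and ZC: "\<forall>x \<in> X. Z x = ?D x * C"
    using Z unfolding design_matrices_def N_def by blast
  have D: "?D x \<in> carrier_mat (J - 1) N" for x
    unfolding N_def by (rule complete_design_carrier)
  have B: "?B \<in> carrier_mat N N" by (simp add: parameter_action_def N_def)
  have inj_B: "v = 0\<^sub>v N" if v: "v \<in> carrier_vec N" and Bv: "?B *\<^sub>v v = 0\<^sub>v N" for v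
  proof -
    \<comment> \<open>Here \<open>x\<close> ranges over the whole space rather than
      \<open>X\<close>, since identifiability evaluates at zero and at the unit vectors.
      Invertibility of \<open>M\<close> cancels it.\<close>
    have "?D x *\<^sub>v v = 0\<^sub>v (J - 1)" if x: "x \<in> carrier_vec p" for x
    proof -
      have "M *\<^sub>v (?D x *\<^sub>v v) = (M * ?D x) *\<^sub>v v"
        using assoc_mult_mat_vec[OF M D v] by simp
      also have "\<dots> = ?D x *\<^sub>v (?B *\<^sub>v v)"
        unfolding mult_complete_design[OF M x] by (rule assoc_mult_mat_vec[OF D B v])
      also have "\<dots> = 0\<^sub>v (J - 1)" unfolding Bv using D[of x] by (intro eq_vecI) auto
      finally show ?thesis
        using det det_0_iff_vec_prod_zero_field[OF M] D v
        by (meson mult_mat_vec_carrier)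
    qed
    then show ?thesis using complete_design_identifiable v unfolding N_def by blast
  qed
  have BC: "?B * C \<in> carrier_mat N q" using B C by simp
  have "v = 0\<^sub>v q" if v: "v \<in> carrier_vec q" and BCv: "(?B * C) *\<^sub>v v = 0\<^sub>v N" for v
  proof -
    have "C *\<^sub>v v = 0\<^sub>v N"
      using mult_mat_vec_carrier[OF C v] BCv unfolding assoc_mult_mat_vec[OF B C v] by (rule inj_B)
    then show ?thesis using rk v vec_space.full_column_rank_iff[OF C] by blast
  qed
  then have "vec_space.rank N (?B * C) = q"
    using vec_space.full_column_rank_iff[OF BC] by blast
  moreover have "M * Z x = ?D x * (?B * C)" if "x \<in> X" for x
  proof -
    have "M * Z x = (M * ?D x) * C"
      using ZC that assoc_mult_mat[OF M D C] by simp
    also have "M * ?D x = ?D x * ?B"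
      by (rule mult_complete_design[OF M]) (use that X in blast)
    also have "\<dots> * C = ?D x * (?B * C)" by (rule assoc_mult_mat[OF D B C])
    finally show ?thesis .
  qed
  ultimately show ?thesis
    using q BC unfolding design_matrices_def N_def by blast
qed

section \<open>Ratios with the logistic cdf as exponential odds\<close>

text \<open>The odds \<open>u / (1 - u)\<close> of \<open>u = logistic w\<close> are
  \<open>exp w\<close>.\<close>

lemma ratio_logistic_iff:
  assumes "0 < a" "0 < b"
  shows "a / (a + b) = logistic w \<longleftrightarrow> a = exp w * b"
proof -
  have pos: "0 < 1 + exp w" by (simp add: add_pos_pos)
  have "0 < logistic w" "logistic w < 1"
    using pos by (simp_all add: logistic_def)
  moreover have "logistic w / (1 - logistic w) = exp w"
    using pos by (simp add: logistic_def field_simps)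
  ultimately show ?thesis using ratio_eq_iff[OF assms, of "logistic w"] by (simp only:)
qed

lemma reference_logistic_iff:
  assumes \<pi>: "\<pi> \<in> probs J" and \<eta>: "\<eta> \<in> carrier_vec (J - 1)"
  shows "reference_ratio J \<pi> = map_vec logistic \<eta> \<longleftrightarrow>
    (\<forall>j < J - 1. cat_prob J \<pi> j = exp (\<eta> $ j) * cat_prob J \<pi> (J - 1))"
proof -
  have "reference_ratio J \<pi> = map_vec logistic \<eta> \<longleftrightarrow>
      (\<forall>j < J - 1. cat_prob J \<pi> j / (cat_prob J \<pi> j + cat_prob J \<pi> (J - 1)) = logistic (\<eta> $ j))"
    using \<eta> by (auto simp: reference_ratio_def vec_eq_iff)
  then show ?thesis
    by (simp only: ratio_logistic_iff[OF cat_prob_pos[OF \<pi>] cat_prob_pos[OF \<pi>]])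
qed

lemma adjacent_logistic_iff:
  assumes \<pi>: "\<pi> \<in> probs J" and \<eta>: "\<eta> \<in> carrier_vec (J - 1)"
  shows "adjacent_ratio J \<pi> = map_vec logistic \<eta> \<longleftrightarrow>
    (\<forall>j < J - 1. cat_prob J \<pi> j = exp (\<eta> $ j) * cat_prob J \<pi> (j + 1))"
proof -
  have "adjacent_ratio J \<pi> = map_vec logistic \<eta> \<longleftrightarrow>
      (\<forall>j < J - 1. cat_prob J \<pi> j / (cat_prob J \<pi> j + cat_prob J \<pi> (j + 1)) = logistic (\<eta> $ j))"
    using \<eta> by (auto simp: adjacent_ratio_def vec_eq_iff)
  then show ?thesis
    by (simp only: ratio_logistic_iff[OF cat_prob_pos[OF \<pi>] cat_prob_pos[OF \<pi>]])
qed

text \<open>Dividing the reference equations at \<open>j\<close> and \<open>j + 1\<close> gives the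
  adjacent ones; conversely, the exponents telescope down to \<open>\<eta> n = 0\<close>.\<close>

lemma exp_telescope_iff:
  fixes c \<eta> :: "nat \<Rightarrow> real"
  assumes "\<eta> n = 0"
  shows "(\<forall>j<n. c j = exp (\<eta> j) * c n) \<longleftrightarrow>
    (\<forall>j<n. c j = exp (\<eta> j - \<eta> (j + 1)) * c (j + 1))" (is "?ref \<longleftrightarrow> ?adj")
proof
  assume ?ref
  then have all: "c j = exp (\<eta> j) * c n" if "j \<le> n" for j
    using that assms by (cases "j = n") auto
  show ?adj
  proof (intro allI impI)
    fix j assume "j < n"
    then show "c j = exp (\<eta> j - \<eta> (j + 1)) * c (j + 1)"
      using all[of j] all[of "j + 1"] by (simp add: exp_diff)
  qed
next
  assume adj: ?adj
  \<comment> \<open>The induction runs downwards from \<open>n\<close>, where the claim is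
    trivial.\<close>
  have "c j = exp (\<eta> j) * c n" if "j \<le> n" for j
    using that
  proof (induction rule: inc_induct)
    case base
    then show ?case using assms by simp
  next
    case (step m)
    then show ?case using adj by (simp add: exp_diff)
  qed
  then show ?ref by (blast intro: less_imp_le)
qed

section \<open>The difference matrix and the equality of the models\<close>

lemma transpose_difference_mult_vec:
  fixes \<eta> :: "real vec"
  assumes \<eta>: "\<eta> \<in> carrier_vec n" and i: "i < n"
  shows "(transpose_mat (mat n n (\<lambda>(i, j). if i = j then 1 else if i = j + 1 then -1 else 0)) *\<^sub>v \<eta>) $ i
    = \<eta> $ i - (if i + 1 < n then \<eta> $ (i + 1) else 0)"
proof -
  have "(transpose_mat (mat n n (\<lambda>(i, j). if i = j then 1 else if i = j + 1 then -1 else 0)) *\<^sub>v \<eta>) $ i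
    = (\<Sum>j<n. (if j = i then \<eta> $ j else 0) - (if j = i + 1 then \<eta> $ j else 0))"
    using assms by (auto simp: scalar_prod_def lessThan_atLeast0 intro!: sum.cong)
  also have "\<dots> = \<eta> $ i - (if i + 1 < n then \<eta> $ (i + 1) else 0)"
    using i by (simp add: sum_subtractf)
  finally show ?thesis .
qed

lemma det_difference_mat:
  "det (mat n n (\<lambda>(i, j). if i = j then 1 else if i = j + 1 then -1 else 0) :: real mat) = 1"
  (is "det ?A = 1")
proof -
  have "det ?A = prod_list (diag_mat ?A)"
    by (rule det_lower_triangular[of n]) auto
  then show ?thesis by (simp add: prod_list_diag_prod)
qed

lemma reference_adjacent_iff:
  assumes \<pi>: "\<pi> \<in> probs J" and \<eta>: "\<eta> \<in> carrier_vec (J - 1)"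
    and A: "A = mat (J - 1) (J - 1) (\<lambda>(i, j). if i = j then 1 else if i = j + 1 then -1 else 0)"
  shows "reference_ratio J \<pi> = map_vec logistic \<eta> \<longleftrightarrow>
    adjacent_ratio J \<pi> = map_vec logistic (transpose_mat A *\<^sub>v \<eta>)"
proof -
  \<comment> \<open>The predictor is extended by 0 at the last category, so that the last row of the
    transpose also becomes a difference.\<close>
  define h where "h j = (if j < J - 1 then \<eta> $ j else 0)" for j
  have "A \<in> carrier_mat (J - 1) (J - 1)" by (simp add: A)
  then have A\<eta>: "transpose_mat A *\<^sub>v \<eta> \<in> carrier_vec (J - 1)" by (simp add: carrier_vecI)
  have diff: "(transpose_mat A *\<^sub>v \<eta>) $ j = h j - h (j + 1)" if "j < J - 1" for j
    unfolding A transpose_difference_mult_vec[OF \<eta> that] using that by (simp add: h_def)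
  have "reference_ratio J \<pi> = map_vec logistic \<eta> \<longleftrightarrow>
      (\<forall>j < J - 1. cat_prob J \<pi> j = exp (h j) * cat_prob J \<pi> (J - 1))"
    unfolding reference_logistic_iff[OF \<pi> \<eta>] by (simp add: h_def)
  also have "\<dots> \<longleftrightarrow>
      (\<forall>j < J - 1. cat_prob J \<pi> j = exp (h j - h (j + 1)) * cat_prob J \<pi> (j + 1))"
    by (rule exp_telescope_iff) (simp add: h_def)
  also have "\<dots> \<longleftrightarrow> adjacent_ratio J \<pi> = map_vec logistic (transpose_mat A *\<^sub>v \<eta>)"
    unfolding adjacent_logistic_iff[OF \<pi> A\<eta>] using diff by (simp only: cong: imp_cong)
  finally show ?thesis .
qed

theorem mainTheorem3:
  fixes J p :: nat and X :: "real vec set" and A :: "real mat" and Z :: "real vec \<Rightarrow> real mat"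
  assumes "J \<ge> 3" and "p \<ge> 1"
    and "X \<noteq> {}" and "X \<subseteq> carrier_vec p"
    and "A = mat (J - 1) (J - 1) (\<lambda>(i, j). if i = j then 1 else if i = j + 1 then -1 else 0)"
    and "Z \<in> design_matrices J p X"
  shows "(\<lambda>x. transpose_mat A * Z x) \<in> design_matrices J p X \<and>
    models_equal J X (reference_ratio J, logistic, Z)
      (adjacent_ratio J, logistic, \<lambda>x. transpose_mat A * Z x)"
proof
  have A: "A \<in> carrier_mat (J - 1) (J - 1)" by (simp add: assms(5))
  then have At: "transpose_mat A \<in> carrier_mat (J - 1) (J - 1)" by simp
  have "det (transpose_mat A) = 1"
    using det_transpose[OF A] det_difference_mat[of "J - 1"] by (simp add: assms(5))
  then show "(\<lambda>x. transpose_mat A * Z x) \<in> design_matrices J p X"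
    using At assms(4,6) by (intro mult_design_matrices) auto
  obtain q C where C: "C \<in> carrier_mat ((J - 1) * (1 + p)) q"
    and ZC: "\<forall>x \<in> X. Z x = complete_design J p x * C"
    using assms(6) unfolding design_matrices_def by blast
  have Z: "Z x \<in> carrier_mat (J - 1) q" if "x \<in> X" for x
    using ZC that mult_carrier_mat[OF complete_design_carrier C] by simp
  have "model_prob J (reference_ratio J, logistic, Z) x \<beta> =
      model_prob J (adjacent_ratio J, logistic, \<lambda>x. transpose_mat A * Z x) x \<beta>"
    if x: "x \<in> X" and \<beta>: "\<beta> \<in> carrier_vec q" for x \<beta>
  proof -
    have \<eta>: "Z x *\<^sub>v \<beta> \<in> carrier_vec (J - 1)" using Z[OF x] \<beta> by simp
    \<comment> \<open>Both models select \<open>\<pi>\<close> from \<open>probs J\<close> by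
      equivalent conditions, so their definite descriptions coincide.\<close>
    have "reference_ratio J \<pi> = map_vec logistic (Z x *\<^sub>v \<beta>) \<longleftrightarrow>
        adjacent_ratio J \<pi> = map_vec logistic ((transpose_mat A * Z x) *\<^sub>v \<beta>)"
      if "\<pi> \<in> probs J" for \<pi>
      unfolding assoc_mult_mat_vec[OF At Z[OF x] \<beta>]
      by (rule reference_adjacent_iff[OF that \<eta> assms(5)])
    then show ?thesis by (simp only: model_prob.simps cong: conj_cong)
  qed
  \<comment> \<open>Nonemptiness of \<open>X\<close> pins the dimension to \<open>q\<close>; over an
    empty \<open>X\<close> every vector would qualify.\<close>
  moreover have "param_space X (reference_ratio J, logistic, Z) = carrier_vec q"
    using Z assms(3) by (auto simp: carrier_matD(2)[OF Z])
  moreover have "param_space X (adjacent_ratio J, logistic, \<lambda>x. transpose_mat A * Z x) = carrier_vec q"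
    using Z assms(3) by (auto simp: carrier_matD(2)[OF Z])
  ultimately show "models_equal J X (reference_ratio J, logistic, Z)
      (adjacent_ratio J, logistic, \<lambda>x. transpose_mat A * Z x)"
    unfolding models_equal_def by blast
qed

end
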